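(* Let $f:\mathbb{R}^N\to\mathbb{R}^N$ be dissipative in the broken Sobolev inner product $\langle\cdot,\cdot\rangle_{W^{k,2}_c}$, that is, $\langle \mathbf{u},f(\mathbf{u})\rangle_{W^{k,2}_c}\le 0$ for all $\mathbf{u}\in\mathbb{R}^N$. Consider an explicit $s$-stage Runge-Kutta method whose coefficients $a_{ij},b_i$ are all nonnegative. Given $\mathbf{u}^n\in\mathbb{R}^N$, define the stages and the relaxed update with time step $\Delta t>0$ by $$\mathbf{u}^{(i)}=\mathbf{u}^n+\Delta t\sum_{j=1}^{s}a_{ij}f(\mathbf{u}^{(j)}),\quad i=1,\dots,s,\qquad \mathbf{u}^{n+1}_\gamma=\mathbf{u}^n+\gamma^n\Delta t\sum_{i=1}^{s}b_i f(\mathbf{u}^{(i)}),$$ where the relaxation parameter is $$\gamma^n=\begin{cases}\dfrac{2\sum_{i,j=1}^{s}b_ia_{ij}\langle f(\mathbf{u}^{(j)}),f(\mathbf{u}^{(i)})\rangle_{W^{k,2}_c}}{\sum_{i,j=1}^{s}b_ib_j\langle f(\mathbf{u}^{(i)}),f(\mathbf{u}^{(j)})\rangle_{W^{k,2}_c}} & \text{if } \sum_{i,j=1}^{s}b_ib_j\langle f(\mathbf{u}^{(i)}),f(\mathbf{u}^{(j)})\rangle_{W^{k,2}_c}\neq 0,\\[2ex] 1 & \text{if } \sum_{i,j=1}^{s}b_ib_j\langle f(\mathbf{u}^{(i)}),f(\mathbf{u}^{(j)})\rangle_{W^{k,2}_c}=0.\end{cases}$$ If $\Delta t$ is chosen such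 that $\gamma^n\ge 0$, then the relaxation method is monotonicity preserving in the broken Sobolev norm: $$\|\mathbf{u}^{n+1}_\gamma\|_{W^{k,2}_c}\le\|\mathbf{u}^n\|_{W^{k,2}_c}.$$
   Context: The ODE $\frac{d\mathbf{u}}{dt}=f(\mathbf{u})$ on $\mathbb{R}^N$ is the autonomous system obtained from a nonlinearly stable flux reconstruction (NSFR) spatial semidiscretization; $\mathbf{u}$ denotes the vector of modal coefficients. The discrete broken Sobolev inner product is $\langle\mathbf{a},\mathbf{b}\rangle_{W^{k,2}_c}:=\mathbf{a}^T(\mathcal{M}+\mathcal{K})\mathbf{b}$, with induced norm $\|\mathbf{a}\|_{W^{k,2}_c}=\langle\mathbf{a},\mathbf{a}\rangle_{W^{k,2}_c}^{1/2}$. Here $\mathcal{M}$ is the symmetric positive definite mass matrix and $\mathcal{K}$ is the symmetric flux reconstruction correction matrix (in one space dimension, with polynomial degree $q$ of the basis, it is given elementwise by $\mathcal{K}=c\,(\mathcal{D}^q)^T\mathcal{M}\mathcal{D}^q$, where $\mathcal{D}$ is the modal differentiation matrix and $c$ is the correction parameter), such that $\mathcal{M}+\mathcal{K}$ is symmetric positive definite. Only these properties of $\mathcal{M}$ and $\mathcal{K}$ are relevant. The energy (numerical entropy) is $\eta(\mathbf{u})=\tfrac12\langle\mathbf{u},\mathbf{u}\rangle_{W^{k,2}_c}$. An explicit Runge-Kutta method has $a_{ij}=0$ for $j\ge i$. A method is called monotonicity preserving if $\|\mathbf{u}^{n+1}\|_{W^{k,2}_c}\le\|\mathbf{u}^n\|_{W^{k,2}_c}$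 for dissipative systems. *)

theory Defs
  imports "HOL-Analysis.Analysis"
begin

definition spd_matrix :: "real ^ 'n ^ 'n \<Rightarrow> bool" where
  "spd_matrix A \<longleftrightarrow> transpose A = A \<and> (\<forall>x. x \<noteq> 0 \<longrightarrow> x \<bullet> (A *v x) > 0)"

definition sobolev_inner ::
    "real ^ 'n ^ 'n \<Rightarrow> real ^ 'n ^ 'n \<Rightarrow> real ^ 'n \<Rightarrow> real ^ 'n \<Rightarrow> real" where
  "sobolev_inner M K x y = x \<bullet> ((M + K) *v y)"

definition sobolev_norm ::
    "real ^ 'n ^ 'n \<Rightarrow> real ^ 'n ^ 'n \<Rightarrow> real ^ 'n \<Rightarrow> real" where
  "sobolev_norm M K x = sqrt (sobolev_inner M K x x)"

definition dissipative ::
    "real ^ 'n ^ 'n \<Rightarrow> real ^ 'n ^ 'n \<Rightarrow> (real ^ 'n \<Rightarrow> real ^ 'n) \<Rightarrow> bool" where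
  "dissipative M K f \<longleftrightarrow> (\<forall>u. sobolev_inner M K u (f u) \<le> 0)"

text \<open>Runge-Kutta coefficients are functions on the natural numbers of which only the values at
  stage indices in \<open>{1..s}\<close> are used.\<close>

definition rk_explicit :: "nat \<Rightarrow> (nat \<Rightarrow> nat \<Rightarrow> real) \<Rightarrow> bool" where
  "rk_explicit s a \<longleftrightarrow> (\<forall>i\<in>{1..s}. \<forall>j\<in>{1..s}. i \<le> j \<longrightarrow> a i j = 0)"

text \<open>The stage equations are stated as a system. For an explicit scheme they determine
  \<open>U 1, \<dots>, U s\<close> uniquely, by recursion on the stage index.\<close>

definition rk_stages ::
    "nat \<Rightarrow> (nat \<Rightarrow> nat \<Rightarrow> real) \<Rightarrow> (real ^ 'n \<Rightarrow> real ^ 'n) \<Rightarrow> real \<Rightarrow> real ^ 'n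
      \<Rightarrow> (nat \<Rightarrow> real ^ 'n) \<Rightarrow> bool" where
  "rk_stages s a f dt u U \<longleftrightarrow>
     (\<forall>i\<in>{1..s}. U i = u + dt *\<^sub>R (\<Sum>j=1..s. a i j *\<^sub>R f (U j)))"

definition relaxation_param ::
    "real ^ 'n ^ 'n \<Rightarrow> real ^ 'n ^ 'n \<Rightarrow> nat \<Rightarrow> (nat \<Rightarrow> nat \<Rightarrow> real) \<Rightarrow> (nat \<Rightarrow> real)
      \<Rightarrow> (real ^ 'n \<Rightarrow> real ^ 'n) \<Rightarrow> (nat \<Rightarrow> real ^ 'n) \<Rightarrow> real" where
  "relaxation_param M K s a b f U =
     (if (\<Sum>i=1..s. \<Sum>j=1..s. b i * b j * sobolev_inner M K (f (U i)) (f (U j))) \<noteq> 0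
      then 2 * (\<Sum>i=1..s. \<Sum>j=1..s. b i * a i j * sobolev_inner M K (f (U j)) (f (U i)))
             / (\<Sum>i=1..s. \<Sum>j=1..s. b i * b j * sobolev_inner M K (f (U i)) (f (U j)))
      else 1)"

definition relaxed_update ::
    "nat \<Rightarrow> (nat \<Rightarrow> real) \<Rightarrow> (real ^ 'n \<Rightarrow> real ^ 'n) \<Rightarrow> real \<Rightarrow> real \<Rightarrow> real ^ 'n
      \<Rightarrow> (nat \<Rightarrow> real ^ 'n) \<Rightarrow> real ^ 'n" where
  "relaxed_update s b f \<gamma> dt u U = u + (\<gamma> * dt) *\<^sub>R (\<Sum>i=1..s. b i *\<^sub>R f (U i))"

end

(*
  Write d = \<Sum> b_i f(U_i), D = <d, d> and A = \<Sum> b_i a_ij <f(U_j), f(U_i)>.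
  Substituting u = U_i - dt \<Sum> a_ij f(U_j) into <u, d> gives
  <u, d> = \<Sum> b_i <U_i, f(U_i)> - dt A, so the squared norm changes by
  2 \<gamma> dt \<Sum> b_i <U_i, f(U_i)> + \<gamma> dt^2 (\<gamma> D - 2 A).
  The first term is nonpositive by dissipativity; if D is nonzero, \<gamma> is chosen exactly so that
  the second vanishes, and if D = 0 then d = 0 by definiteness and the update does nothing.
*)
theory Submission
  imports Defs
begin

lemma bilinear_sobolev_inner: "bilinear (sobolev_inner M K)"
  unfolding bilinear_def sobolev_inner_def
  by (auto intro!: linearI simp: inner_add_left inner_add_right matrix_vector_right_distrib
      matrix_vector_mult_scaleR)

text \<open>The matrix moves across the dot product as its transpose, which is the matrix
  itself.\<close>

lemma sobolev_inner_commute: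
  assumes "transpose (M + K) = M + K"
  shows "sobolev_inner M K x y = sobolev_inner M K y x"
  unfolding sobolev_inner_def
  by (metis assms dot_lmul_matrix inner_commute transpose_matrix_vector)

text \<open>Serves the degenerate case of the relaxation parameter: a vanishing denominator forces
  the combined increment itself to vanish.\<close>

lemma sobolev_inner_eq_0_iff:
  assumes "spd_matrix (M + K)"
  shows "sobolev_inner M K x x = 0 \<longleftrightarrow> x = 0"
  using assms unfolding spd_matrix_def sobolev_inner_def
  by (metis inner_zero_left less_irrefl)

text \<open>Bilinear expansion of the square; symmetry merges the two cross terms into one.\<close>

lemma sobolev_inner_add_scaleR:
  assumes "transpose (M + K) = M + K"
  shows "sobolev_inner M K (u + c *\<^sub>R d) (u + c *\<^sub>R d)
    = sobolev_inner M K u u + 2 * c * sobolev_inner M K u d + c\<^sup>2 * sobolev_inner M K d d"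
  using sobolev_inner_commute[OF assms, of d u] bilinear_sobolev_inner[of M K]
  by (simp add: bilinear_ladd bilinear_radd bilinear_lmul bilinear_rmul algebra_simps
      power2_eq_square)

lemma sobolev_inner_sum_scaleR_right:
  "sobolev_inner M K x (\<Sum>i\<in>I. c i *\<^sub>R v i) = (\<Sum>i\<in>I. c i * sobolev_inner M K x (v i))"
proof -
  have "linear (sobolev_inner M K x)"
    using bilinear_sobolev_inner unfolding bilinear_def by blast
  then show ?thesis by (simp add: linear_sum linear_cmul)
qed

lemma sobolev_inner_sum_scaleR_left:
  "sobolev_inner M K (\<Sum>i\<in>I. c i *\<^sub>R v i) x = (\<Sum>i\<in>I. c i * sobolev_inner M K (v i) x)"
proof -
  have "linear (\<lambda>y. sobolev_inner M K y x)"
    using bilinear_sobolev_inner unfolding bilinear_def by blast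
  then show ?thesis by (simp add: linear_sum[of "\<lambda>y. sobolev_inner M K y x"]
        linear_cmul[of "\<lambda>y. sobolev_inner M K y x"])
qed

text \<open>Dissipativity controls \<open>f (U i)\<close> only against its own argument
  \<open>U i\<close>, not against \<open>u\<close>. Solving the stage equation for \<open>u\<close>
  trades one for the other, at the cost of products between stage derivatives.\<close>

lemma sobolev_inner_stage:
  assumes "rk_stages s a f dt u U" "i \<in> {1..s}"
  shows "sobolev_inner M K u (f (U i)) = sobolev_inner M K (U i) (f (U i))
    - dt * (\<Sum>j=1..s. a i j * sobolev_inner M K (f (U j)) (f (U i)))"
proof -
  have "U i = u + dt *\<^sub>R (\<Sum>j=1..s. a i j *\<^sub>R f (U j))"
    using assms unfolding rk_stages_def by blast
  then have "sobolev_inner M K (U i) y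
      = sobolev_inner M K u y + dt * sobolev_inner M K (\<Sum>j=1..s. a i j *\<^sub>R f (U j)) y" for y
    by (simp add: bilinear_ladd[OF bilinear_sobolev_inner] bilinear_lmul[OF bilinear_sobolev_inner])
  then show ?thesis by (simp add: sobolev_inner_sum_scaleR_left)
qed

theorem mainTheorem1:
  fixes M K :: "real ^ 'n ^ 'n"
    and f :: "real ^ 'n \<Rightarrow> real ^ 'n"
    and s :: nat
    and a :: "nat \<Rightarrow> nat \<Rightarrow> real"
    and b :: "nat \<Rightarrow> real"
    and dt \<gamma> :: real
    and u :: "real ^ 'n"
    and U :: "nat \<Rightarrow> real ^ 'n"
  assumes "spd_matrix M"
    and "transpose K = K"
    and "spd_matrix (M + K)"
    and "dissipative M K f"
    and "rk_explicit s a"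
    and "\<forall>i\<in>{1..s}. \<forall>j\<in>{1..s}. a i j \<ge> 0"
    and "\<forall>i\<in>{1..s}. b i \<ge> 0"
    and "dt > 0"
    and "rk_stages s a f dt u U"
    and "\<gamma> = relaxation_param M K s a b f U"
    and "\<gamma> \<ge> 0"
  shows "sobolev_norm M K (relaxed_update s b f \<gamma> dt u U) \<le> sobolev_norm M K u"
proof -
  have sym: "transpose (M + K) = M + K"
    using assms(3) unfolding spd_matrix_def by blast
  define d where "d = (\<Sum>i=1..s. b i *\<^sub>R f (U i))"
  define A where "A = (\<Sum>i=1..s. \<Sum>j=1..s. b i * a i j * sobolev_inner M K (f (U j)) (f (U i)))"
  define S where "S = (\<Sum>i=1..s. b i * sobolev_inner M K (U i) (f (U i)))"
  \<comment> \<open>The denominator of the relaxation parameter is a Gram form, hence the squared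
    norm of \<open>d\<close>.\<close>
  have D: "(\<Sum>i=1..s. \<Sum>j=1..s. b i * b j * sobolev_inner M K (f (U i)) (f (U j)))
      = sobolev_inner M K d d"
    unfolding d_def sobolev_inner_sum_scaleR_left
    by (simp add: sobolev_inner_sum_scaleR_right sum_distrib_left mult.assoc)
  have update: "relaxed_update s b f \<gamma> dt u U = u + (\<gamma> * dt) *\<^sub>R d"
    by (simp add: relaxed_update_def d_def)
  have "sobolev_inner M K (u + (\<gamma> * dt) *\<^sub>R d) (u + (\<gamma> * dt) *\<^sub>R d) \<le> sobolev_inner M K u u"
  proof (cases "sobolev_inner M K d d = 0")
    case True
    then have "d = 0" using sobolev_inner_eq_0_iff[OF assms(3)] by blast
    then show ?thesis by simp
  next
    case False
    have "\<gamma> = 2 * A / sobolev_inner M K d d"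
      using assms(10) False unfolding relaxation_param_def D A_def[symmetric] by simp
    then have \<gamma>D: "\<gamma> * sobolev_inner M K d d = 2 * A" using False by simp
    have "sobolev_inner M K u d = (\<Sum>i=1..s. b i * sobolev_inner M K u (f (U i)))"
      by (simp add: d_def sobolev_inner_sum_scaleR_right)
    also have "\<dots> = (\<Sum>i=1..s. b i * sobolev_inner M K (U i) (f (U i))
        - dt * (\<Sum>j=1..s. b i * a i j * sobolev_inner M K (f (U j)) (f (U i))))"
      by (rule sum.cong) (simp_all add: sobolev_inner_stage[OF assms(9)] right_diff_distrib
          sum_distrib_left mult_ac)
    also have "\<dots> = S - dt * A"
      by (simp add: S_def A_def sum_subtractf sum_distrib_left)
    finally have ud: "sobolev_inner M K u d = S - dt * A" .
    \<comment> \<open>The quadratic term is grouped around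
      \<open>\<gamma> * sobolev_inner M K d d\<close> so that it can be replaced by
      \<open>2 * A\<close>, which cancels the \<open>A\<close> part of the cross term
      exactly.\<close>
    have "sobolev_inner M K (u + (\<gamma> * dt) *\<^sub>R d) (u + (\<gamma> * dt) *\<^sub>R d)
        = sobolev_inner M K u u + 2 * (\<gamma> * dt) * (S - dt * A)
          + \<gamma> * dt\<^sup>2 * (\<gamma> * sobolev_inner M K d d)"
      by (simp add: sobolev_inner_add_scaleR[OF sym] ud power2_eq_square)
    also have "\<dots> = sobolev_inner M K u u + 2 * (\<gamma> * dt) * S"
      unfolding \<gamma>D by (simp add: algebra_simps power2_eq_square)
    finally have "sobolev_inner M K (u + (\<gamma> * dt) *\<^sub>R d) (u + (\<gamma> * dt) *\<^sub>R d)
        = sobolev_inner M K u u + 2 * (\<gamma> * dt) * S" .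
    \<comment> \<open>Dissipativity is applied at each stage value, and the nonnegative weights
      \<open>b i\<close> preserve the sign.\<close>
    moreover have "S \<le> 0"
      unfolding S_def using assms(4,7)
      by (intro sum_nonpos mult_nonneg_nonpos) (auto simp: dissipative_def)
    \<comment> \<open>Here the sign condition on \<gamma> enters: the effective step
      \<open>\<gamma> * dt\<close> must not point backwards in time.\<close>
    then have "2 * (\<gamma> * dt) * S \<le> 0"
      using assms(8,11) by (intro mult_nonneg_nonpos) auto
    ultimately show ?thesis by linarith
  qed
  then show ?thesis
    unfolding sobolev_norm_def update by (rule real_sqrt_le_mono)
qed

end
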